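(* Let $0<a<b$ and $s\in(0,1)$. Then $$\left|A^s(a,b)-L_s^s(a,b)\right|\le (b-a)\,\frac{s}{(s+1)(s+2)}\Big(1-\frac{1}{2^{s+1}}\Big)\left[a^{s-1}+b^{s-1}\right].$$
   Context: For positive reals $a\neq b$: $A(a,b)=\frac{a+b}{2}$ is the arithmetic mean, and for $p\in\mathbb{R}\setminus\{-1,0\}$, $L_p(a,b)=\left[\frac{b^{p+1}-a^{p+1}}{(p+1)(b-a)}\right]^{1/p}$ is the $p$-logarithmic mean. $A^s(a,b)$ and $L_s^s(a,b)$ denote $(A(a,b))^s$ and $(L_s(a,b))^s$. *)

theory Defs
  imports Complex_Main
begin

definition arith_mean :: "real \<Rightarrow> real \<Rightarrow> real" where
  "arith_mean a b = (a + b) / 2"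

(* Meaningful for positive a, b with a \<noteq> b and p not in {-1, 0}; then the base of the
   outer power is positive. Elsewhere the value is an artefact of totality. *)
definition log_mean :: "real \<Rightarrow> real \<Rightarrow> real \<Rightarrow> real" where
  "log_mean p a b = ((b powr (p + 1) - a powr (p + 1)) / ((p + 1) * (b - a))) powr (1 / p)"

end

theory Submission
  imports Defs "HOL-Analysis.Convex"
begin

text \<open>
  Fix the midpoint $m$ of $[a,b]$ and let the half-length $t$ vary: the defect
  $D(t) = 2 t m^s - ((m+t)^{s+1} - (m-t)^{s+1})/(s+1)$ vanishes at $0$, and its derivative
  $2 m^s - (m+t)^s - (m-t)^s$ lies between $0$ and $s t a^{s-1}$ since $x^s$ is concave and
  increasing. Integrating up to $(b-a)/2$ gives
  $0 \le A^s - L_s^s \le (b-a) s a^{s-1} / 8$, and the constant of the theorem is at least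
  $s/8$ because $2^{-s} \le 1 - s/2$.
\<close>

text \<open>Weighted AM-GM gives \<open>x powr s * y powr (1 - s) \<le> s * x + (1 - s) * y\<close>;
  multiplying by \<open>y powr (s - 1)\<close> turns this into concavity of the power, its graph
  lying below the tangent at \<open>y\<close>.\<close>

lemma powr_le_tangent:
  fixes x y s :: real
  assumes "0 < x" "0 < y" "0 \<le> s" "s \<le> 1"
  shows "x powr s \<le> y powr s + s * y powr (s - 1) * (x - y)"
proof -
  have "x powr s * y powr (1 - s) \<le> s * x + (1 - s) * y"
    using assms by (intro Youngs_inequality_0) auto
  then have "x powr s * y powr (1 - s) * y powr (s - 1) \<le> (s * x + (1 - s) * y) * y powr (s - 1)"
    by (rule mult_right_mono) simp
  moreover have "y powr (1 - s) * y powr (s - 1) = 1"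
    using assms by (simp flip: powr_add)
  moreover have "y * y powr (s - 1) = y powr s"
    using assms by (simp add: powr_mult_base)
  ultimately show ?thesis
    by (simp add: algebra_simps)
qed

lemma midpoint_defect_bounds:
  fixes m h s :: real
  assumes "0 \<le> h" "h < m" "0 < s" "s \<le> 1"
  defines "D \<equiv> (\<lambda>t. 2 * t * m powr s - ((m + t) powr (s + 1) - (m - t) powr (s + 1)) / (s + 1))"
  shows "0 \<le> D h" and "D h \<le> s * (m - h) powr (s - 1) * h\<^sup>2 / 2"
proof -
  define D' where "D' t = 2 * m powr s - (m + t) powr s - (m - t) powr s" for t
  have deriv: "(D has_real_derivative D' t) (at t)" if "0 \<le> t" "t \<le> h" for t
  proof -
    have "((\<lambda>t. (m + t) powr (s + 1)) has_real_derivative (s + 1) * (m + t) powr s) (at t)"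
      "((\<lambda>t. (m - t) powr (s + 1)) has_real_derivative - ((s + 1) * (m - t) powr s)) (at t)"
      using that assms by (auto intro!: derivative_eq_intros)
    then have "(D has_real_derivative 2 * m powr s
        - ((s + 1) * (m + t) powr s - - ((s + 1) * (m - t) powr s)) / (s + 1)) (at t)"
      unfolding D_def by (intro DERIV_diff DERIV_cdivide) (auto intro!: derivative_eq_intros)
    then show ?thesis
      using \<open>0 < s\<close> by (simp add: D'_def add_divide_distrib diff_diff_eq)
  qed
  have bounds: "0 \<le> D' t" "D' t \<le> s * (m - h) powr (s - 1) * t" if t: "0 \<le> t" "t \<le> h" for t
  proof -
    \<comment> \<open>Both points \<open>m + t\<close> and \<open>m - t\<close> are compared with
      the same tangent at \<open>m\<close>, so the linear terms cancel in the sum.\<close>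
    show "0 \<le> D' t"
      using powr_le_tangent[of "m + t" m s] powr_le_tangent[of "m - t" m s] t assms
      by (simp add: D'_def)
    \<comment> \<open>The exponent \<open>s - 1\<close> is nonpositive, so the slope at
      \<open>m - t\<close> is largest at the endpoint \<open>t = h\<close>, where the base is still
      positive.\<close>
    have "(m - t) powr (s - 1) \<le> (m - h) powr (s - 1)"
      using t assms by (intro powr_mono2') auto
    then have "s * (m - t) powr (s - 1) * t \<le> s * (m - h) powr (s - 1) * t"
      using t assms by (intro mult_right_mono mult_left_mono) auto
    moreover have "m powr s \<le> (m + t) powr s"
      using t assms by (intro powr_mono2) auto
    \<comment> \<open>Here the tangent is taken at the left point \<open>m - t\<close>, which bounds
      the increase of the power up to \<open>m\<close> from above. The other half of
      \<open>D' t\<close>, namely \<open>m powr s - (m + t) powr s\<close>, is at most 0.\<close>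
    moreover have "m powr s \<le> (m - t) powr s + s * (m - t) powr (s - 1) * t"
      using powr_le_tangent[of m "m - t" s] t assms by simp
    ultimately show "D' t \<le> s * (m - h) powr (s - 1) * t"
      unfolding D'_def by linarith
  qed
  have "D 0 = 0"
    by (simp add: D_def)
  moreover have "D 0 \<le> D h"
    using deriv bounds(1) by (intro DERIV_nonneg_imp_nondecreasing[OF \<open>0 \<le> h\<close>]) blast
  ultimately show "0 \<le> D h"
    by simp
  \<comment> \<open>Monotonicity of the gap \<open>G\<close> replaces integrating the bound on
    \<open>D'\<close> from 0 to \<open>h\<close>.\<close>
  define G where "G t = s * (m - h) powr (s - 1) * t\<^sup>2 / 2 - D t" for t
  have "(G has_real_derivative s * (m - h) powr (s - 1) * t - D' t) (at t)"
    if "0 \<le> t" "t \<le> h" for t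
    unfolding G_def by (rule derivative_eq_intros deriv that refl | simp)+
  then have "G 0 \<le> G h"
    using bounds(2)
    by (intro DERIV_nonneg_imp_nondecreasing[OF \<open>0 \<le> h\<close>]) (metis diff_ge_0_iff_ge)
  with \<open>D 0 = 0\<close> show "D h \<le> s * (m - h) powr (s - 1) * h\<^sup>2 / 2"
    by (simp add: G_def)
qed

lemma log_mean_powr_self:
  fixes a b s :: real
  assumes "0 < a" "a < b" "0 < s"
  shows "log_mean s a b powr s = (b powr (s + 1) - a powr (s + 1)) / ((s + 1) * (b - a))"
proof -
  \<comment> \<open>This makes the base of the outer power nonnegative, so that raising it to
    \<open>1 / s\<close> and then to \<open>s\<close> gives it back.\<close>
  have "a powr (s + 1) \<le> b powr (s + 1)"
    using assms by (intro powr_mono2) auto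
  then show ?thesis
    using assms by (simp add: log_mean_def powr_powr)
qed

lemma arith_mean_log_mean_powr_bounds:
  fixes a b s :: real
  assumes "0 < a" "a < b" "0 < s" "s \<le> 1"
  defines "d \<equiv> arith_mean a b powr s - log_mean s a b powr s"
  shows "0 \<le> d" and "d \<le> (b - a) * s / 8 * a powr (s - 1)"
proof -
  define m h where "m = (a + b) / 2" and "h = (b - a) / 2"
  have h: "0 < h" "h < m"
    using assms by (auto simp: m_def h_def field_simps)
  have ab: "a = m - h" "b = m + h"
    by (auto simp: m_def h_def field_simps)
  define D where "D = 2 * h * m powr s - ((m + h) powr (s + 1) - (m - h) powr (s + 1)) / (s + 1)"
  \<comment> \<open>The interval has length \<open>2 * h\<close>, so \<open>D\<close> is the
    difference of the two means' powers with that denominator cleared.\<close>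
  have "d = D / (2 * h)"
    unfolding d_def log_mean_powr_self[OF assms(1-3)]
    using h assms(3) by (simp add: arith_mean_def ab D_def diff_divide_distrib mult.commute)
  moreover have D: "0 \<le> D" "D \<le> s * (m - h) powr (s - 1) * h\<^sup>2 / 2"
    using midpoint_defect_bounds[of h m s] h assms(3,4) by (simp_all add: D_def)
  moreover have "D / (2 * h) \<le> s * (m - h) powr (s - 1) * h\<^sup>2 / 2 / (2 * h)"
    using D h by (intro divide_right_mono) auto
  ultimately show "0 \<le> d" "d \<le> (b - a) * s / 8 * a powr (s - 1)"
    using h by (simp_all add: ab power2_eq_square mult_ac)
qed

text \<open>This compares the sharper constant from the midpoint argument with the one in the
  theorem; the two agree at \<open>s = 1\<close>.\<close>

lemma eighth_le_s_convex_constant: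
  fixes s :: real
  assumes "0 \<le> s" "s \<le> 1"
  shows "1 / 8 \<le> (1 - 1 / 2 powr (s + 1)) / ((s + 1) * (s + 2))"
proof -
  \<comment> \<open>Tangent to the power at 1, evaluated at \<open>1 / 2\<close>.\<close>
  have "(1 / 2) powr s \<le> 1 - s / 2"
    using powr_le_tangent[of "1 / 2" 1 s] assms by simp
  then have "1 / 2 powr (s + 1) \<le> (1 - s / 2) / 2"
    by (simp add: powr_add powr_divide)
  \<comment> \<open>The right side equals \<open>4 + 2 * s\<close>, and it exceeds the left by
    \<open>(2 + s) * (1 - s)\<close>.\<close>
  moreover have "(s + 1) * (s + 2) \<le> 8 * (1 - (1 - s / 2) / 2)"
    using mult_nonneg_nonneg[of "2 + s" "1 - s"] assms by (simp add: field_simps)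
  ultimately have "(s + 1) * (s + 2) \<le> 8 * (1 - 1 / 2 powr (s + 1))"
    by argo
  then show ?thesis
    using assms by (simp add: pos_le_divide_eq)
qed

theorem proposition1:
  fixes a b s :: real
  assumes "0 < a" and "a < b" and "s \<in> {0<..<1}"
  shows "\<bar>arith_mean a b powr s - log_mean s a b powr s\<bar>
    \<le> (b - a) * (s / ((s + 1) * (s + 2))) * (1 - 1 / 2 powr (s + 1))
       * (a powr (s - 1) + b powr (s - 1))"
proof -
  define c where "c = (1 - 1 / 2 powr (s + 1)) / ((s + 1) * (s + 2))"
  have s: "0 < s" "s \<le> 1"
    using assms by auto
  have "1 / 8 \<le> c"
    using eighth_le_s_convex_constant[of s] s by (simp add: c_def)
  have "\<bar>arith_mean a b powr s - log_mean s a b powr s\<bar> \<le> (b - a) * s * (1 / 8) * a powr (s - 1)"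
    using arith_mean_log_mean_powr_bounds[of a b s] assms s by simp
  \<comment> \<open>Two enlargements at once: \<open>1 / 8\<close> grows to \<open>c\<close>, and
    the nonnegative term \<open>b powr (s - 1)\<close> is added.\<close>
  also have "\<dots> \<le> (b - a) * s * c * (a powr (s - 1) + b powr (s - 1))"
    using \<open>1 / 8 \<le> c\<close> assms s by (intro mult_mono mult_left_mono) auto
  also have "\<dots> = (b - a) * (s / ((s + 1) * (s + 2))) * (1 - 1 / 2 powr (s + 1))
       * (a powr (s - 1) + b powr (s - 1))"
    by (simp add: c_def)
  finally show ?thesis .
qed

end
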